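(* Let $F(x,t)=\gamma(x)+t\xi(x)$ be a $k$-th pseudo cylindrical ruled surface with associated functions $p,q,r,\delta$ as in the context, where $q(x)=\tilde q(x)x^{Q}$, and let $Q\ge k$. Let $S(F)$ be the set of singular points of $F$ and $V=\{(x,t)\in I\times\mathbb{R} : x\neq 0\}$. Then: (1) $F(S(F)\cap V)$ coincides with the striction curve of $F$ if and only if $r\equiv 0$; (2) $F(S(F)\cap V)=\emptyset$ if and only if there exist a function $\tilde r$ and an integer $R$ such that $r(x)=\tilde r(x)x^{R}$ and $\tilde r(0)\neq 0$.
   Context: Everything is considered as a germ at $x=0$: $I\subset\mathbb{R}$ is an open interval containing $0$, which may be shrunk. Let $\gamma:I\to\mathbb{R}^3$ with $\gamma(0)=0$ and $\xi:I\to S^2$ be real analytic. The ruled surface is $F:I\times\mathbb{R}\to\mathbb{R}^3$, $F(x,t)=\gamma(x)+t\xi(x)$. It is called $k$-th pseudo cylindrical ($k\in\mathbb{Z}_{\ge 0}$) if $\xi'(x)=\tilde\xi(x)x^{k}$ with $\tilde\xi(0)\neq\mathbf 0$. Put $\xi_d=\tilde\xi/\|\tilde\xi\|$, so $\{\xi,\xi_d,\xi\times\xi_d\}$ is an orthonormal frame, and $\delta(x)=\langle\xi'(x),\xi_d(x)\rangle=\|\tilde\xi(x)\|x^{k}$. The functions $p,q,r:I\to\mathbb{R}$ are defined by $\gamma'=p\,\xi+q\,\xi_d+r\,(\xi\times\xi_d)$. Write $q(x)=\tilde q(x)x^{Q}$ with $Q\in\mathbb{Z}_{\ge0}$ (it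 is not assumed that $\tilde q(0)\ne0$). Here $\tilde q$ and $\tilde r$ denote functions of the same regularity as the data, and $R\in\mathbb{Z}_{\ge0}$. A point $(x,t)$ is a singular point of $F$ if $\operatorname{rank} dF_{(x,t)}<2$. A curve $s(x)=F(x,t(x))$ is called a striction curve of $F$ if $\langle s'(x),\xi_d(x)\rangle\equiv 0$; this gives $t(x)=-q(x)/\delta(x)=-\dfrac{\tilde q(x)}{\|\tilde\xi(x)\|}x^{Q-k}$, so $s(x)=\gamma(x)-\dfrac{\tilde q(x)}{\|\tilde\xi(x)\|}x^{Q-k}\xi(x)$, which is well defined at $x=0$ if and only if $Q\ge k$.
   Formalization: In (1), the striction curve is taken over x≠0, i.e. F(S(F)∩V) is compared with s(I∖{0}); equality with the whole curve s(I) fails, e.g. for the tangent developable of an embedded space curve, where r≡0 but s(0) is not in F(S(F)∩V). *)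

theory Defs
  imports "HOL-Analysis.Analysis"
begin

definition real_analytic_on :: "(real \<Rightarrow> 'a::real_normed_vector) \<Rightarrow> real set \<Rightarrow> bool" where
  "real_analytic_on f A \<longleftrightarrow>
     (\<forall>a\<in>A. \<exists>\<epsilon>>0. \<exists>c :: nat \<Rightarrow> 'a.
        \<forall>x\<in>ball a \<epsilon>. (\<lambda>n. (x - a) ^ n *\<^sub>R c n) sums f x)"

definition open_interval_around_0 :: "real set \<Rightarrow> bool" where
  "open_interval_around_0 J \<longleftrightarrow> open J \<and> is_interval J \<and> 0 \<in> J"

definition ruled_surface ::
    "(real \<Rightarrow> real ^ 3) \<Rightarrow> (real \<Rightarrow> real ^ 3) \<Rightarrow> real \<times> real \<Rightarrow> real ^ 3" where
  "ruled_surface \<gamma> \<xi> = (\<lambda>(x, t). \<gamma> x + t *\<^sub>R \<xi> x)"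

text \<open>The factor \<open>\<xi>t\<close> plays the role of \<open>\<xi>\<close> with a tilde. It is only required to be nonzero at 0,
  so it may vanish elsewhere on a large \<open>I\<close>.\<close>

definition pseudo_cylindrical ::
    "nat \<Rightarrow> real set \<Rightarrow> (real \<Rightarrow> real ^ 3) \<Rightarrow> (real \<Rightarrow> real ^ 3) \<Rightarrow> bool" where
  "pseudo_cylindrical k I \<xi> \<xi>t \<longleftrightarrow>
     real_analytic_on \<xi>t I \<and>
     (\<forall>x\<in>I. (\<xi> has_vector_derivative x ^ k *\<^sub>R \<xi>t x) (at x)) \<and>
     \<xi>t 0 \<noteq> 0"

text \<open>Meaningful only where \<open>\<xi>t x \<noteq> 0\<close>; the value is 0 otherwise.\<close>

definition xi_d :: "(real \<Rightarrow> real ^ 3) \<Rightarrow> real \<Rightarrow> real ^ 3" where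
  "xi_d \<xi>t x = \<xi>t x /\<^sub>R norm (\<xi>t x)"

definition singular_points :: "real set \<Rightarrow> (real \<times> real \<Rightarrow> real ^ 3) \<Rightarrow> (real \<times> real) set" where
  "singular_points J F =
     {(x, t). x \<in> J \<and> dim (range (frechet_derivative F (at (x, t)))) < 2}"

definition striction_curve ::
    "real set \<Rightarrow> (real \<times> real \<Rightarrow> real ^ 3) \<Rightarrow> (real \<Rightarrow> real ^ 3) \<Rightarrow> (real \<Rightarrow> real ^ 3) \<Rightarrow> bool" where
  "striction_curve J F \<xi>d s \<longleftrightarrow>
     (\<exists>t. real_analytic_on t J \<and> (\<forall>x\<in>J. s x = F (x, t x))) \<and>
     (\<forall>x\<in>J. vector_derivative s (at x) \<bullet> \<xi>d x = 0)"

end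

theory Submission
  imports Defs "HOL-Complex_Analysis.Cauchy_Integral_Formula"
begin

text \<open>Where \<open>\<xi>t \<noteq> 0\<close>, the partial derivatives of \<open>F\<close> in the orthonormal frame \<open>\<xi>, \<xi>\<^sub>d, \<xi> \<times> \<xi>\<^sub>d\<close> are
  \<open>F\<^sub>t = \<xi>\<close> and \<open>F\<^sub>x = p \<xi> + (q + t \<delta>) \<xi>\<^sub>d + r (\<xi> \<times> \<xi>\<^sub>d)\<close>, so \<open>(x, t)\<close> is singular iff \<open>q + t \<delta> = 0\<close> and
  \<open>r x = 0\<close>; and \<open>q + t \<delta> = 0\<close> is also the equation of the striction curve. Hence the singular points
  with \<open>x \<noteq> 0\<close> map onto the part of the striction curve over the zeros of \<open>r\<close>. As \<open>r\<close> is real analytic,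
  near \<open>0\<close> it either vanishes identically or is \<open>x ^ R\<close> times a function without zeros, and \<open>I0\<close> is
  chosen so small that this dichotomy holds on it.

  Analyticity of products, derivatives and \<open>1 / \<parallel>\<xi>t\<parallel>\<close> is obtained by extending to holomorphic functions.\<close>

subsection \<open>Real analytic functions of one variable\<close>

text \<open>The same coefficients define a complex power series, and convergence at all real points
  of the ball forces convergence on the complex disc of the same radius.\<close>

lemma power_series_holomorphic_extension:
  fixes f :: "real \<Rightarrow> real"
  assumes f: "\<And>x. x \<in> ball a e \<Longrightarrow> (\<lambda>n. (x - a) ^ n *\<^sub>R c n) sums f x"
  obtains g where "g holomorphic_on ball (complex_of_real a) e"
    "\<And>x. x \<in> ball a e \<Longrightarrow> g (complex_of_real x) = complex_of_real (f x)"
proof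
  define g where "g w = (\<Sum>n. complex_of_real (c n) * (w - complex_of_real a) ^ n)" for w
  show "g holomorphic_on ball (complex_of_real a) e"
  proof (rule power_series_holomorphic)
    fix w assume "w \<in> ball (complex_of_real a) e"
    then have "norm (w - complex_of_real a) < e"
      by (simp add: dist_norm norm_minus_commute)
    \<comment> \<open>The real point \<open>a + b\<close> is farther from the centre than
      \<open>w\<close>, so convergence there carries over to \<open>w\<close>.\<close>
    then obtain b where b: "norm (w - complex_of_real a) < b" "b < e"
      using dense by blast
    then have "b > 0"
      using norm_ge_zero[of "w - complex_of_real a"] by linarith
    then have "(\<lambda>n. b ^ n *\<^sub>R c n) sums f (a + b)"
      using f[of "a + b"] b by (simp add: dist_norm)
    then have "summable (\<lambda>n. complex_of_real (b ^ n *\<^sub>R c n))"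
      using summable_of_real sums_summable by blast
    then have "summable (\<lambda>n. complex_of_real (c n) * complex_of_real b ^ n)"
      by (simp add: mult.commute)
    then have "summable (\<lambda>n. complex_of_real (c n) * (w - complex_of_real a) ^ n)"
      by (rule powser_inside) (use b \<open>b > 0\<close> in simp)
    then show "(\<lambda>n. complex_of_real (c n) * (w - complex_of_real a) ^ n) sums g w"
      unfolding g_def by (rule summable_sums)
  qed
  show "g (complex_of_real x) = complex_of_real (f x)" if "x \<in> ball a e" for x
  proof -
    have "(\<lambda>n. complex_of_real ((x - a) ^ n *\<^sub>R c n)) sums complex_of_real (f x)"
      using f[OF that] by (simp only: sums_of_real_iff)
    then have "(\<lambda>n. complex_of_real (c n) * (complex_of_real x - complex_of_real a) ^ n) sums complex_of_real (f x)"
      by (simp add: mult.commute)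
    then show ?thesis
      unfolding g_def by (simp add: sums_iff)
  qed
qed

lemma real_analytic_on_holomorphic_extension:
  fixes f :: "real \<Rightarrow> real"
  assumes "real_analytic_on f A" "a \<in> A"
  obtains e g where "e > 0" "g holomorphic_on ball (complex_of_real a) e"
    "\<And>x. x \<in> ball a e \<Longrightarrow> g (complex_of_real x) = complex_of_real (f x)"
proof -
  obtain e c where "e > 0" "\<And>x. x \<in> ball a e \<Longrightarrow> (\<lambda>n. (x - a) ^ n *\<^sub>R c n) sums f x"
    using assms unfolding real_analytic_on_def by blast
  then show thesis
    using power_series_holomorphic_extension[of a e c f] that by blast
qed

text \<open>Converse passage: at real points the powers of \<open>x - a\<close> are real, so the
  real parts of the Taylor coefficients of \<open>g\<close> at \<open>a\<close> form a real
  expansion of \<open>f\<close>.\<close>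

lemma real_analytic_on_Re_holomorphic:
  fixes f :: "real \<Rightarrow> real"
  assumes "\<And>a. a \<in> A \<Longrightarrow> \<exists>e>0. \<exists>g. g holomorphic_on ball (complex_of_real a) e \<and>
      (\<forall>x\<in>ball a e. f x = Re (g (complex_of_real x)))"
  shows "real_analytic_on f A"
  unfolding real_analytic_on_def
proof
  fix a assume "a \<in> A"
  then obtain e g where e: "e > 0" and g: "g holomorphic_on ball (complex_of_real a) e"
    and f: "\<And>x. x \<in> ball a e \<Longrightarrow> f x = Re (g (complex_of_real x))"
    using assms by blast
  define c where "c n = Re ((deriv ^^ n) g (complex_of_real a) / fact n)" for n
  have "(\<lambda>n. (x - a) ^ n *\<^sub>R c n) sums f x" if x: "x \<in> ball a e" for x
  proof -
    have "complex_of_real x \<in> ball (complex_of_real a) e"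
      using x by simp
    then have "(\<lambda>n. (deriv ^^ n) g (complex_of_real a) / fact n * (complex_of_real x - complex_of_real a) ^ n)
        sums g (complex_of_real x)"
      using holomorphic_power_series[OF g] by blast
    then have "(\<lambda>n. Re ((deriv ^^ n) g (complex_of_real a) / fact n * (complex_of_real x - complex_of_real a) ^ n))
        sums Re (g (complex_of_real x))"
      by (rule sums_Re)
    moreover have "Re (w * (complex_of_real x - complex_of_real a) ^ n) = (x - a) ^ n *\<^sub>R Re w" for w n
      by (simp flip: of_real_diff of_real_power)
    ultimately show ?thesis
      unfolding c_def f[OF x] by (simp only:)
  qed
  then show "\<exists>e>0. \<exists>c. \<forall>x\<in>ball a e. (\<lambda>n. (x - a) ^ n *\<^sub>R c n) sums f x"
    using e by blast
qed

text \<open>\<open>real_analytic_on\<close> asks for an expansion about every point of the ball, not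
  just its centre; the holomorphic extension supplies the re-expansions.\<close>

lemma real_analytic_on_power_series:
  fixes f :: "real \<Rightarrow> real"
  assumes f: "\<And>x. x \<in> ball a e \<Longrightarrow> (\<lambda>n. (x - a) ^ n *\<^sub>R c n) sums f x"
  shows "real_analytic_on f (ball a e)"
proof -
  obtain g where g: "g holomorphic_on ball (complex_of_real a) e"
    "\<And>x. x \<in> ball a e \<Longrightarrow> g (complex_of_real x) = complex_of_real (f x)"
    using power_series_holomorphic_extension[OF f] by blast
  show ?thesis
  proof (rule real_analytic_on_Re_holomorphic)
    fix b assume "b \<in> ball a e"
    then obtain d where d: "d > 0" "ball b d \<subseteq> ball a e"
      using open_contains_ball open_ball by blast
    have "ball (complex_of_real b) (e - dist a b) \<subseteq> ball (complex_of_real a) e"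
    proof
      fix z assume "z \<in> ball (complex_of_real b) (e - dist a b)"
      then show "z \<in> ball (complex_of_real a) e"
        using dist_triangle[of "complex_of_real a" z "complex_of_real b"] by simp
    qed
    then have "ball (complex_of_real b) (min d (e - dist a b)) \<subseteq> ball (complex_of_real a) e"
      by force
    with g(1) have "g holomorphic_on ball (complex_of_real b) (min d (e - dist a b))"
      using holomorphic_on_subset by blast
    moreover have "f x = Re (g (complex_of_real x))" if "x \<in> ball b (min d (e - dist a b))" for x
    proof -
      have "x \<in> ball a e" using that d by auto
      then show ?thesis using g(2) by simp
    qed
    moreover have "min d (e - dist a b) > 0"
      using d \<open>b \<in> ball a e\<close> by simp
    ultimately show "\<exists>e>0. \<exists>g. g holomorphic_on ball (complex_of_real b) e \<and>
      (\<forall>x\<in>ball b e. f x = Re (g (complex_of_real x)))"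
      by blast
  qed
qed

lemma real_analytic_on_subset:
  "real_analytic_on f A \<Longrightarrow> B \<subseteq> A \<Longrightarrow> real_analytic_on f B"
  unfolding real_analytic_on_def by blast

text \<open>The expansion of \<open>f\<close> may live on a ball that leaves \<open>A\<close>;
  openness of \<open>A\<close> allows shrinking it to where \<open>f\<close> and \<open>g\<close>
  agree.\<close>

lemma real_analytic_on_cong:
  assumes "open A" "real_analytic_on f A" "\<And>x. x \<in> A \<Longrightarrow> f x = g x"
  shows "real_analytic_on g A"
  unfolding real_analytic_on_def
proof
  fix a assume "a \<in> A"
  then obtain d where d: "d > 0" "ball a d \<subseteq> A"
    using assms(1) open_contains_ball by blast
  obtain e c where "e > 0" "\<forall>x\<in>ball a e. (\<lambda>n. (x - a) ^ n *\<^sub>R c n) sums f x"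
    using assms(2) \<open>a \<in> A\<close> unfolding real_analytic_on_def by blast
  then have "\<forall>x\<in>ball a (min d e). (\<lambda>n. (x - a) ^ n *\<^sub>R c n) sums g x"
    using d assms(3) by (metis Int_iff ball_min_Int subsetD)
  with d(1) \<open>e > 0\<close> show "\<exists>e>0. \<exists>c. \<forall>x\<in>ball a e. (\<lambda>n. (x - a) ^ n *\<^sub>R c n) sums g x"
    by (metis min_less_iff_conj)
qed

lemma real_analytic_on_linear_image:
  assumes "bounded_linear h" "real_analytic_on f A"
  shows "real_analytic_on (\<lambda>x. h (f x)) A"
  unfolding real_analytic_on_def
proof
  fix a assume "a \<in> A"
  then obtain e c where e: "e > 0" and c: "\<And>x. x \<in> ball a e \<Longrightarrow> (\<lambda>n. (x - a) ^ n *\<^sub>R c n) sums f x"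
    using assms unfolding real_analytic_on_def by blast
  have "(\<lambda>n. (x - a) ^ n *\<^sub>R h (c n)) sums h (f x)" if "x \<in> ball a e" for x
    using bounded_linear.sums[OF assms(1) c[OF that]]
    by (simp add: linear_scale bounded_linear.linear[OF assms(1)])
  then show "\<exists>e>0. \<exists>c. \<forall>x\<in>ball a e. (\<lambda>n. (x - a) ^ n *\<^sub>R c n) sums h (f x)"
    using e by (intro exI[of _ e]) (auto intro!: exI[of _ "\<lambda>n. h (c n)"])
qed

lemma real_analytic_on_add:
  assumes "real_analytic_on f A" "real_analytic_on g A"
  shows "real_analytic_on (\<lambda>x. f x + g x) A"
  unfolding real_analytic_on_def
proof
  fix a assume "a \<in> A"
  then obtain e c e' c' where e: "e > 0" "e' > 0"
    and c: "\<And>x. x \<in> ball a e \<Longrightarrow> (\<lambda>n. (x - a) ^ n *\<^sub>R c n) sums f x"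
      "\<And>x. x \<in> ball a e' \<Longrightarrow> (\<lambda>n. (x - a) ^ n *\<^sub>R c' n) sums g x"
    using assms unfolding real_analytic_on_def by meson
  have "(\<lambda>n. (x - a) ^ n *\<^sub>R (c n + c' n)) sums (f x + g x)" if "x \<in> ball a (min e e')" for x
    using sums_add[OF c(1)[of x] c(2)[of x]] that by (simp add: scaleR_add_right)
  then show "\<exists>e>0. \<exists>c. \<forall>x\<in>ball a e. (\<lambda>n. (x - a) ^ n *\<^sub>R c n) sums (f x + g x)"
    using e by (intro exI[of _ "min e e'"]) (auto intro!: exI[of _ "\<lambda>n. c n + c' n"])
qed

lemma real_analytic_on_minus:
  "real_analytic_on f A \<Longrightarrow> real_analytic_on (\<lambda>x. - f x) A"
  by (rule real_analytic_on_linear_image[OF bounded_linear_minus[OF bounded_linear_ident]])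

lemma real_analytic_on_diff:
  "real_analytic_on f A \<Longrightarrow> real_analytic_on g A \<Longrightarrow> real_analytic_on (\<lambda>x. f x - g x) A"
  using real_analytic_on_add[OF _ real_analytic_on_minus] by simp

text \<open>Multiplying the holomorphic extensions takes the place of a Cauchy product of the two
  series.\<close>

lemma real_analytic_on_mult:
  fixes f g :: "real \<Rightarrow> real"
  assumes "real_analytic_on f A" "real_analytic_on g A"
  shows "real_analytic_on (\<lambda>x. f x * g x) A"
proof (rule real_analytic_on_Re_holomorphic)
  fix a assume "a \<in> A"
  obtain e u where u: "e > 0" "u holomorphic_on ball (complex_of_real a) e"
    "\<And>x. x \<in> ball a e \<Longrightarrow> u (complex_of_real x) = complex_of_real (f x)"
    using real_analytic_on_holomorphic_extension[OF assms(1) \<open>a \<in> A\<close>] by blast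
  obtain d v where v: "d > 0" "v holomorphic_on ball (complex_of_real a) d"
    "\<And>x. x \<in> ball a d \<Longrightarrow> v (complex_of_real x) = complex_of_real (g x)"
    using real_analytic_on_holomorphic_extension[OF assms(2) \<open>a \<in> A\<close>] by blast
  have "(\<lambda>z. u z * v z) holomorphic_on ball (complex_of_real a) (min e d)"
    by (intro holomorphic_on_mult holomorphic_on_subset[OF u(2)] holomorphic_on_subset[OF v(2)]) auto
  then show "\<exists>e>0. \<exists>h. h holomorphic_on ball (complex_of_real a) e \<and>
      (\<forall>x\<in>ball a e. f x * g x = Re (h (complex_of_real x)))"
    using u v by (intro exI[of _ "min e d"] conjI exI[of _ "\<lambda>z. u z * v z"]) auto
qed

lemma real_analytic_on_power_ident:
  "real_analytic_on (\<lambda>x. x ^ n :: real) A"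
  by (rule real_analytic_on_Re_holomorphic)
    (intro exI[of _ 1] conjI exI[of _ "\<lambda>z. z ^ n"], auto intro!: holomorphic_intros simp flip: of_real_power)

text \<open>Serves for \<open>inverse (norm (\<xi>t x))\<close>. The principal root
  \<open>csqrt\<close> is holomorphic off the nonpositive reals, which the extension avoids near
  \<open>a\<close> because its value there is positive.\<close>

lemma real_analytic_on_inverse_sqrt:
  fixes f :: "real \<Rightarrow> real"
  assumes "real_analytic_on f A" "\<And>x. x \<in> A \<Longrightarrow> f x > 0"
  shows "real_analytic_on (\<lambda>x. inverse (sqrt (f x))) A"
proof (rule real_analytic_on_Re_holomorphic)
  fix a assume "a \<in> A"
  obtain e g where g: "e > 0" "g holomorphic_on ball (complex_of_real a) e"
    "\<And>x. x \<in> ball a e \<Longrightarrow> g (complex_of_real x) = complex_of_real (f x)"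
    using real_analytic_on_holomorphic_extension[OF assms(1) \<open>a \<in> A\<close>] by blast
  \<comment> \<open>Continuity of \<open>g\<close> yields a smaller disc on which
    \<open>Re (g z) > 0\<close>.\<close>
  have "continuous_on (ball (complex_of_real a) e) g"
    using g(2) by (rule holomorphic_on_imp_continuous_on)
  then have "open {z \<in> ball (complex_of_real a) e. g z \<in> {w. Re w > 0}}"
    using continuous_open_preimage[OF _ open_ball open_halfspace_Re_gt[of 0]]
    by (simp add: vimage_def Int_def)
  moreover have "complex_of_real a \<in> {z \<in> ball (complex_of_real a) e. g z \<in> {w. Re w > 0}}"
    using g \<open>a \<in> A\<close> assms(2) by simp
  ultimately obtain d where d: "d > 0"
    "ball (complex_of_real a) d \<subseteq> {z \<in> ball (complex_of_real a) e. g z \<in> {w. Re w > 0}}"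
    using open_contains_ball by meson
  have "(\<lambda>z. inverse (csqrt (g z))) holomorphic_on ball (complex_of_real a) d"
  proof (intro holomorphic_intros holomorphic_on_subset[OF g(2)])
    fix z assume "z \<in> ball (complex_of_real a) d"
    then have "Re (g z) > 0" using d by blast
    then show "g z \<notin> \<real>\<^sub>\<le>\<^sub>0" "csqrt (g z) \<noteq> 0"
      by (auto simp: complex_nonpos_Reals_iff)
  qed (use d in auto)
  moreover have "inverse (sqrt (f x)) = Re (inverse (csqrt (g (complex_of_real x))))"
    if "x \<in> ball a d" for x
  proof -
    have "complex_of_real x \<in> ball (complex_of_real a) d"
      using that by simp
    then have "complex_of_real x \<in> ball (complex_of_real a) e" "Re (g (complex_of_real x)) > 0"
      using d by blast+
    moreover from this have "x \<in> ball a e"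
      by simp
    ultimately show ?thesis using g(3)[of x]
      by (simp flip: of_real_sqrt of_real_inverse)
  qed
  ultimately show "\<exists>e>0. \<exists>g. g holomorphic_on ball (complex_of_real a) e \<and>
      (\<forall>x\<in>ball a e. inverse (sqrt (f x)) = Re (g (complex_of_real x)))"
    using d(1) by blast
qed

text \<open>The complex derivative of the extension is again holomorphic and restricts to the given
  real derivative.\<close>

lemma real_analytic_on_derivative:
  fixes f f' :: "real \<Rightarrow> real"
  assumes "real_analytic_on f A" "open A"
    and f': "\<And>x. x \<in> A \<Longrightarrow> (f has_real_derivative f' x) (at x)"
  shows "real_analytic_on f' A"
proof (rule real_analytic_on_Re_holomorphic)
  fix a assume "a \<in> A"
  obtain e g where g: "e > 0" "g holomorphic_on ball (complex_of_real a) e"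
    "\<And>x. x \<in> ball a e \<Longrightarrow> g (complex_of_real x) = complex_of_real (f x)"
    using real_analytic_on_holomorphic_extension[OF assms(1) \<open>a \<in> A\<close>] by blast
  obtain d where d: "d > 0" "ball a d \<subseteq> A"
    using assms(2) \<open>a \<in> A\<close> open_contains_ball by blast
  have "deriv g holomorphic_on ball (complex_of_real a) (min e d)"
    using holomorphic_deriv[OF g(2) open_ball] by (rule holomorphic_on_subset) auto
  moreover have "f' x = Re (deriv g (complex_of_real x))" if x: "x \<in> ball a (min e d)" for x
  proof -
    have "complex_of_real x \<in> ball (complex_of_real a) e"
      using x by simp
    then have "(g has_field_derivative deriv g (complex_of_real x)) (at (complex_of_real x))"
      using holomorphic_derivI[OF g(2) open_ball] by blast
    \<comment> \<open>Along the real axis \<open>g\<close> and \<open>f\<close> trace the same curve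
      in the complex plane, so uniqueness of vector derivatives identifies the two
      derivatives.\<close>
    then have "((\<lambda>x. g (complex_of_real x)) has_vector_derivative deriv g (complex_of_real x)) (at x)"
      by (rule has_vector_derivative_real_field)
    then have "((\<lambda>x. complex_of_real (f x)) has_vector_derivative deriv g (complex_of_real x)) (at x)"
      by (rule has_vector_derivative_transform_within_open[OF _ open_ball[of a e]]) (use x g in auto)
    moreover have "((\<lambda>x. complex_of_real (f x)) has_vector_derivative complex_of_real (f' x)) (at x)"
      using f'[of x] x d by (intro has_vector_derivative_of_real) (auto simp: has_real_derivative_iff_has_vector_derivative subset_iff)
    ultimately have "deriv g (complex_of_real x) = complex_of_real (f' x)"
      by (rule vector_derivative_unique_at)
    then show ?thesis by simp
  qed
  ultimately show "\<exists>e>0. \<exists>g. g holomorphic_on ball (complex_of_real a) e \<and>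
      (\<forall>x\<in>ball a e. f' x = Re (g (complex_of_real x)))"
    using g(1) d(1) by (intro exI[of _ "min e d"]) auto
qed

lemma real_analytic_on_differentiable:
  fixes f :: "real \<Rightarrow> real"
  assumes "real_analytic_on f A" "a \<in> A"
  shows "f differentiable at a"
proof -
  obtain e g where g: "e > 0" "g holomorphic_on ball (complex_of_real a) e"
    "\<And>x. x \<in> ball a e \<Longrightarrow> g (complex_of_real x) = complex_of_real (f x)"
    using real_analytic_on_holomorphic_extension[OF assms] by blast
  have "(g has_field_derivative deriv g (complex_of_real a)) (at (complex_of_real a))"
    using holomorphic_derivI[OF g(2) open_ball] g(1) by simp
  then have "((\<lambda>x. g (complex_of_real x)) has_vector_derivative deriv g (complex_of_real a)) (at a)"
    by (rule has_vector_derivative_real_field)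
  then have "((\<lambda>x. complex_of_real (f x)) has_vector_derivative deriv g (complex_of_real a)) (at a)"
    by (rule has_vector_derivative_transform_within_open[OF _ open_ball[of a e]]) (use g in auto)
  then have "((\<lambda>x. Re (complex_of_real (f x))) has_vector_derivative Re (deriv g (complex_of_real a))) (at a)"
    by (rule bounded_linear.has_vector_derivative[OF bounded_linear_Re])
  then show ?thesis
    by (auto simp: has_vector_derivative_def differentiable_def)
qed

lemma real_analytic_on_imp_isCont:
  fixes f :: "real \<Rightarrow> real"
  assumes "real_analytic_on f A" "a \<in> A"
  shows "isCont f a"
  using real_analytic_on_differentiable[OF assms] by (rule differentiable_imp_continuous_within)

text \<open>Isolation of zeros: either all coefficients at 0 vanish, or the power of
  \<open>x\<close> at the first nonzero one splits off, leaving a factor that is nonzero at 0 and,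
  by continuity, nearby.\<close>

lemma real_analytic_on_zero_or_factor:
  fixes f :: "real \<Rightarrow> real"
  assumes "real_analytic_on f A" "0 \<in> A"
  obtains e where "e > 0" "\<And>x. x \<in> ball 0 e \<Longrightarrow> f x = 0"
  | e h n where "e > 0" "real_analytic_on h (ball 0 e)" "\<And>x. x \<in> ball 0 e \<Longrightarrow> f x = h x * x ^ n"
    "\<And>x. x \<in> ball 0 e \<Longrightarrow> h x \<noteq> 0"
proof -
  obtain e c where e: "e > 0" and "\<And>x. x \<in> ball 0 e \<Longrightarrow> (\<lambda>n. (x - 0) ^ n *\<^sub>R c n) sums f x"
    using assms unfolding real_analytic_on_def by blast
  then have c: "\<And>x. x \<in> ball 0 e \<Longrightarrow> (\<lambda>n. x ^ n * c n) sums f x"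
    by simp
  show thesis
  proof (cases "\<forall>n. c n = 0")
    case True
    then have "f x = 0" if "x \<in> ball 0 e" for x
      using c[OF that] sums_unique by fastforce
    then show thesis using that(1) e by blast
  next
    case False
    define n where "n = (LEAST n. c n \<noteq> 0)"
    have n: "c n \<noteq> 0"
      unfolding n_def using False by (metis (mono_tags, lifting) LeastI)
    have n0: "c i = 0" if "i < n" for i
      using that not_less_Least unfolding n_def by blast
    \<comment> \<open>The quotient is completed at 0 by the leading coefficient, which makes
      \<open>h\<close> the sum of the shifted series there too.\<close>
    define h where "h x = (if x = 0 then c n else f x / x ^ n)" for x
    have h: "(\<lambda>i. x ^ i * c (i + n)) sums h x" if x: "x \<in> ball 0 e" for x
    proof (cases "x = 0")
      case True
      then show ?thesis
        using powser_sums_zero[of "\<lambda>i. c (i + n)"] by (simp add: h_def mult.commute)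
    next
      case False
      \<comment> \<open>The subtracted initial terms are all zero, so dividing by
        \<open>x ^ n\<close> just shifts the series.\<close>
      have "(\<lambda>i. x ^ (i + n) * c (i + n)) sums (f x - (\<Sum>i<n. x ^ i * c i))"
        using sums_split_initial_segment[OF c[OF x], of n] .
      then have "(\<lambda>i. x ^ (i + n) * c (i + n) / x ^ n) sums (f x / x ^ n)"
        using sums_divide[of _ _ "x ^ n"] n0 by simp
      then show ?thesis
        using False by (simp add: h_def power_add)
    qed
    have ana: "real_analytic_on h (ball 0 e)"
      by (rule real_analytic_on_power_series[of _ _ "\<lambda>i. c (i + n)"]) (use h in simp)
    have "isCont h 0"
      using real_analytic_on_imp_isCont[OF ana] e by simp
    moreover have "h 0 \<noteq> 0"
      using n by (simp add: h_def)
    ultimately have "\<forall>\<^sub>F x in nhds 0. h x \<noteq> 0"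
      using tendsto_imp_eventually_ne[of h "h 0" "nhds 0" 0] by (simp add: isCont_def tendsto_nhds_iff)
    then obtain d where d: "d > 0" "\<And>x. x \<in> ball 0 d \<Longrightarrow> h x \<noteq> 0"
      by (auto simp: eventually_nhds_metric dist_commute)
    have "f x = h x * x ^ n" if "x \<in> ball 0 e" for x
    proof (cases "x = 0")
      case True
      \<comment> \<open>The value \<open>f 0 = c 0\<close> is \<open>h 0\<close> if
        \<open>n = 0\<close> and zero otherwise.\<close>
      have "(\<lambda>n. c n * 0 ^ n) sums f 0"
        using c[of 0] e by (simp add: mult.commute)
      then have "f 0 = c 0"
        using powser_sums_zero sums_unique2 by blast
      then show ?thesis
        using True n n0[of 0] by (cases n) (auto simp: h_def)
    qed (simp add: h_def)
    then show thesis
      using that(2)[of "min e d" h n] e d 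
        real_analytic_on_subset[OF ana subset_ball[of "min e d" e]] by auto
  qed
qed

text \<open>The limit at \<open>a\<close> ignores the value at \<open>a\<close>. This handles the
  point 0, where a power of \<open>x\<close> cannot be cancelled.\<close>

lemma isCont_zero_punctured:
  fixes f :: "real \<Rightarrow> real"
  assumes "isCont f a" "open J" "a \<in> J" "\<And>x. x \<in> J - {a} \<Longrightarrow> f x = 0"
  shows "f a = 0"
proof -
  have "\<forall>\<^sub>F x in at a. f x = 0"
    using assms(2-4) by (auto simp: eventually_at_topological)
  then have "f \<midarrow>a\<rightarrow> 0"
    by (simp add: tendsto_eventually)
  then show ?thesis
    using assms(1) LIM_unique by (auto simp: isCont_def)
qed

lemma open_minus_point_nonempty:
  fixes J :: "real set"
  assumes "open J" "a \<in> J"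
  shows "J - {a} \<noteq> {}"
  using assms by (metis Diff_eq_empty_iff empty_iff not_open_singleton subset_singletonD)

lemma real_analytic_on_vec_nth:
  "real_analytic_on f A \<Longrightarrow> real_analytic_on (\<lambda>x. f x $ i) A"
  by (rule real_analytic_on_linear_image[OF bounded_linear_vec_nth])

lemma real_analytic_on_inner:
  fixes f g :: "real \<Rightarrow> real ^ 3"
  assumes "real_analytic_on f A" "real_analytic_on g A"
  shows "real_analytic_on (\<lambda>x. f x \<bullet> g x) A"
  unfolding inner_vec_def sum_3 inner_real_def
  by (intro real_analytic_on_add real_analytic_on_mult real_analytic_on_vec_nth assms)

subsection \<open>Singular points and striction curves of ruled surfaces\<close>

text \<open>By Lagrange's identity the squared length is the Gram determinant of \<open>a\<close>
  and \<open>b\<close>.\<close>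

lemma frame_norm_cross3:
  fixes a b :: "real ^ 3"
  assumes "norm a = 1" "norm b = 1" "a \<bullet> b = 0"
  shows "cross3 a b \<bullet> cross3 a b = 1"
  using assms by (simp add: dot_cross norm_eq_1)

lemma has_derivative_ruled_surface:
  assumes "(\<gamma> has_vector_derivative \<gamma>') (at x)" "(\<xi> has_vector_derivative \<xi>') (at x)"
  shows "(ruled_surface \<gamma> \<xi> has_derivative
    (\<lambda>(u, v). u *\<^sub>R (\<gamma>' + t *\<^sub>R \<xi>') + v *\<^sub>R \<xi> x)) (at (x, t))"
proof -
  have fst: "(fst has_derivative fst) (at (x, t))" and snd: "(snd has_derivative snd) (at (x, t))"
    by (rule has_derivative_fst has_derivative_snd, rule has_derivative_ident)+
  have "((\<lambda>z. \<gamma> (fst z)) has_derivative (\<lambda>h. fst h *\<^sub>R \<gamma>')) (at (x, t))"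
    "((\<lambda>z. \<xi> (fst z)) has_derivative (\<lambda>h. fst h *\<^sub>R \<xi>')) (at (x, t))"
    using has_derivative_compose[OF fst, of \<gamma>] has_derivative_compose[OF fst, of \<xi>] assms
    by (simp_all add: has_vector_derivative_def)
  from has_derivative_add[OF this(1) has_derivative_scaleR[OF snd this(2)]]
  show ?thesis
    by (simp add: ruled_surface_def case_prod_unfold algebra_simps)
qed

text \<open>The range is spanned by \<open>a\<close> and \<open>b\<close>, and \<open>b\<close>
  alone already contributes dimension 1.\<close>

lemma dim_range_less_2_iff:
  fixes a b :: "'a::euclidean_space"
  assumes "b \<noteq> 0"
  shows "dim (range (\<lambda>(u, v). u *\<^sub>R a + v *\<^sub>R b)) < 2 \<longleftrightarrow> a \<in> span {b}"
proof -
  have "range (\<lambda>(u, v). u *\<^sub>R a + v *\<^sub>R b) = span {a, b}"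
    by (fastforce simp: span_breakdown_eq span_singleton image_iff algebra_simps)
  moreover have "dim {a, b} = (if a \<in> span {b} then 1 else 2)"
    using assms by (simp add: dim_insert)
  ultimately show ?thesis
    by simp
qed

text \<open>The rank drops when the \<open>x\<close>-derivative \<open>w\<close> is parallel to the
  \<open>t\<close>-derivative \<open>\<xi> x\<close>, which is read off by pairing \<open>w\<close>
  with the other two frame vectors.\<close>

lemma singular_points_ruled_surface_iff:
  fixes \<gamma> \<xi> :: "real \<Rightarrow> real ^ 3"
  assumes \<gamma>: "(\<gamma> has_vector_derivative p *\<^sub>R \<xi> x + q *\<^sub>R b + r *\<^sub>R cross3 (\<xi> x) b) (at x)"
    and \<xi>: "(\<xi> has_vector_derivative d *\<^sub>R b) (at x)"
    and frame: "norm (\<xi> x) = 1" "norm b = 1" "\<xi> x \<bullet> b = 0"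
  shows "(x, t) \<in> singular_points J (ruled_surface \<gamma> \<xi>) \<longleftrightarrow> x \<in> J \<and> q + t * d = 0 \<and> r = 0"
proof -
  define w where "w = p *\<^sub>R \<xi> x + q *\<^sub>R b + r *\<^sub>R cross3 (\<xi> x) b + t *\<^sub>R d *\<^sub>R b"
  have "w \<in> span {\<xi> x} \<longleftrightarrow> q + t * d = 0 \<and> r = 0"
  proof
    assume "w \<in> span {\<xi> x}"
    then obtain c where c: "w = c *\<^sub>R \<xi> x"
      by (auto simp: span_singleton)
    have "w \<bullet> b = q + t * d"
      using frame by (simp add: w_def inner_simps dot_cross_self norm_eq_1)
    moreover have "w \<bullet> cross3 (\<xi> x) b = r"
      using frame frame_norm_cross3[OF frame] by (simp add: w_def inner_simps dot_cross_self)
    ultimately show "q + t * d = 0 \<and> r = 0"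
      using frame by (simp add: c dot_cross_self)
  next
    assume *: "q + t * d = 0 \<and> r = 0"
    have "w = p *\<^sub>R \<xi> x + (q + t * d) *\<^sub>R b"
      by (simp add: w_def conjunct2[OF *] scaleR_add_left)
    then show "w \<in> span {\<xi> x}"
      using * by (simp add: span_base span_scale)
  qed
  moreover have "frechet_derivative (ruled_surface \<gamma> \<xi>) (at (x, t)) = (\<lambda>(u, v). u *\<^sub>R w + v *\<^sub>R \<xi> x)"
    using frechet_derivative_at[OF has_derivative_ruled_surface[OF \<gamma> \<xi>]] by (simp add: w_def)
  moreover have "\<xi> x \<noteq> 0"
    using frame by auto
  ultimately show ?thesis
    by (simp add: singular_points_def dim_range_less_2_iff)
qed

text \<open>Differentiating the factor \<open>t\<close> produces a multiple of
  \<open>\<xi> x\<close>, orthogonal to \<open>b\<close>, so only the value \<open>t x\<close>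
  enters.\<close>

lemma inner_vector_derivative_ruled_curve:
  fixes \<gamma> \<xi> s :: "real \<Rightarrow> real ^ 3"
  assumes \<gamma>: "(\<gamma> has_vector_derivative p *\<^sub>R \<xi> x + q *\<^sub>R b + r *\<^sub>R cross3 (\<xi> x) b) (at x)"
    and \<xi>: "(\<xi> has_vector_derivative d *\<^sub>R b) (at x)"
    and frame: "norm b = 1" "\<xi> x \<bullet> b = 0"
    and t: "t differentiable at x"
    and J: "open J" "x \<in> J"
    and s: "\<And>y. y \<in> J \<Longrightarrow> s y = ruled_surface \<gamma> \<xi> (y, t y)"
  shows "vector_derivative s (at x) \<bullet> b = q + t x * d"
proof -
  obtain t' where "(t has_real_derivative t') (at x)"
    using t by (auto simp: real_differentiable_def)
  then have "((\<lambda>y. \<gamma> y + t y *\<^sub>R \<xi> y) has_vector_derivative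
    p *\<^sub>R \<xi> x + q *\<^sub>R b + r *\<^sub>R cross3 (\<xi> x) b + (t x *\<^sub>R d *\<^sub>R b + t' *\<^sub>R \<xi> x)) (at x)"
    using \<gamma> \<xi> by (intro has_vector_derivative_add has_vector_derivative_scaleR) auto
  then have "(s has_vector_derivative
    p *\<^sub>R \<xi> x + q *\<^sub>R b + r *\<^sub>R cross3 (\<xi> x) b + (t x *\<^sub>R d *\<^sub>R b + t' *\<^sub>R \<xi> x)) (at x)"
    by (rule has_vector_derivative_transform_within_open[OF _ J]) (simp add: s ruled_surface_def)
  from vector_derivative_at[OF this] show ?thesis
    using frame by (simp add: inner_simps dot_cross_self norm_eq_1)
qed

text \<open>The germ at 0 is rendered by an \<open>I0\<close> below which every interval
  \<open>J\<close> works. Existence of a striction curve is claimed as well, so that the equivalence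
  for all such curves is not vacuous. Since \<open>V\<close> omits \<open>x = 0\<close>, the curve
  is compared over \<open>J - {0}\<close>.\<close>

theorem proposition3p3:
  fixes I :: "real set" and k Q :: nat
    and \<gamma> \<xi> \<xi>t :: "real \<Rightarrow> real ^ 3"
    and p q r qt :: "real \<Rightarrow> real"
    and F :: "real \<times> real \<Rightarrow> real ^ 3"
  assumes I: "open_interval_around_0 I"
    and \<gamma>: "real_analytic_on \<gamma> I" "\<gamma> 0 = 0"
    and \<xi>: "real_analytic_on \<xi> I" "\<And>x. x \<in> I \<Longrightarrow> \<xi> x \<in> sphere 0 1"
    and F: "F = ruled_surface \<gamma> \<xi>"
    and pseudo_cyl: "pseudo_cylindrical k I \<xi> \<xi>t"
    and pqr: "\<And>x. x \<in> I \<Longrightarrow> \<xi>t x \<noteq> 0 \<Longrightarrow>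
        (\<gamma> has_vector_derivative
           p x *\<^sub>R \<xi> x + q x *\<^sub>R xi_d \<xi>t x + r x *\<^sub>R cross3 (\<xi> x) (xi_d \<xi>t x)) (at x)"
    and q: "real_analytic_on qt I" "\<And>x. x \<in> I \<Longrightarrow> q x = qt x * x ^ Q"
    and Q: "Q \<ge> k"
  shows "\<exists>I0. open_interval_around_0 I0 \<and> I0 \<subseteq> I \<and>
    (\<forall>J. open_interval_around_0 J \<and> J \<subseteq> I0 \<longrightarrow>
      (let S = singular_points J F; V = {(x, t). x \<in> J \<and> x \<noteq> 0} in
        (\<exists>s. striction_curve J F (xi_d \<xi>t) s) \<and>
        (\<forall>s. striction_curve J F (xi_d \<xi>t) s \<longrightarrow>
           (F ` (S \<inter> V) = s ` (J - {0}) \<longleftrightarrow> (\<forall>x\<in>J. r x = 0))) \<and>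
        (F ` (S \<inter> V) = {} \<longleftrightarrow>
           (\<exists>(rt :: real \<Rightarrow> real) (R :: nat). real_analytic_on rt J \<and>
              (\<forall>x\<in>J. r x = rt x * x ^ R) \<and> rt 0 \<noteq> 0))))"
proof -

  \<comment> \<open>A neighbourhood of 0 on which \<open>\<xi>t\<close> has no zero\<close>
  have "open I" "0 \<in> I" and ana_\<xi>t: "real_analytic_on \<xi>t I" and "\<xi>t 0 \<noteq> 0"
    and \<xi>': "\<And>x. x \<in> I \<Longrightarrow> (\<xi> has_vector_derivative x ^ k *\<^sub>R \<xi>t x) (at x)"
    using I pseudo_cyl by (auto simp: open_interval_around_0_def pseudo_cylindrical_def)
  have unit: "norm (\<xi> x) = 1" if "x \<in> I" for x
    using \<xi>(2)[OF that] by simp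
  \<comment> \<open>The squared length turns nonvanishing of a vector into a statement about a real
    analytic scalar function.\<close>
  have "isCont (\<lambda>x. \<xi>t x \<bullet> \<xi>t x) 0"
    using real_analytic_on_imp_isCont[OF real_analytic_on_inner[OF ana_\<xi>t ana_\<xi>t] \<open>0 \<in> I\<close>] .
  then have "\<forall>\<^sub>F x in nhds 0. \<xi>t x \<bullet> \<xi>t x \<noteq> 0"
    using tendsto_imp_eventually_ne[of "\<lambda>x. \<xi>t x \<bullet> \<xi>t x" "\<xi>t 0 \<bullet> \<xi>t 0" "nhds 0" 0] \<open>\<xi>t 0 \<noteq> 0\<close>
    by (simp add: isCont_def tendsto_nhds_iff)
  moreover have "\<forall>\<^sub>F x in nhds 0. x \<in> I"
    using \<open>open I\<close> \<open>0 \<in> I\<close> by (rule eventually_nhds_in_open)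
  ultimately have "\<forall>\<^sub>F x in nhds 0. x \<in> I \<and> \<xi>t x \<noteq> 0"
    by eventually_elim simp
  then obtain e where "e > 0" and e: "\<And>x. x \<in> ball 0 e \<Longrightarrow> x \<in> I \<and> \<xi>t x \<noteq> 0"
    by (auto simp: eventually_nhds_metric dist_commute)
  define A where "A = ball (0::real) e"
  have A: "open A" "0 \<in> A" "A \<subseteq> I" and \<xi>t_nz: "\<And>x. x \<in> A \<Longrightarrow> \<xi>t x \<noteq> 0"
    using \<open>e > 0\<close> e by (auto simp: A_def)
  note ana = real_analytic_on_subset[OF _ \<open>A \<subseteq> I\<close>]

  \<comment> \<open>The orthonormal frame\<close>
  have perp: "\<xi> x \<bullet> \<xi>t x = 0" if "x \<in> A" for x
  proof -
    have *: "\<xi> x \<bullet> \<xi>t x = 0" if "x \<in> A - {0}" for x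
    proof -
      have "x \<in> I" using that A by blast
      \<comment> \<open>Differentiating the constant squared length of \<open>\<xi>\<close> gives
        the orthogonality up to the factor \<open>x ^ k\<close>, which cancels away from 0.\<close>
      have "((\<lambda>y. \<xi> y \<bullet> \<xi> y) has_vector_derivative (\<xi> x \<bullet> (x ^ k *\<^sub>R \<xi>t x) + (x ^ k *\<^sub>R \<xi>t x) \<bullet> \<xi> x)) (at x)"
        by (rule bounded_bilinear.has_vector_derivative[OF bounded_bilinear_inner \<xi>'[OF \<open>x \<in> I\<close>] \<xi>'[OF \<open>x \<in> I\<close>]])
      moreover have "((\<lambda>y. \<xi> y \<bullet> \<xi> y) has_vector_derivative 0) (at x)"
        by (rule has_vector_derivative_transform_within_open[OF has_vector_derivative_const[of 1] \<open>open I\<close> \<open>x \<in> I\<close>])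
          (use unit norm_eq_1 in metis)
      ultimately have "\<xi> x \<bullet> (x ^ k *\<^sub>R \<xi>t x) + (x ^ k *\<^sub>R \<xi>t x) \<bullet> \<xi> x = 0"
        by (rule vector_derivative_unique_at)
      then show ?thesis
        using that by (simp add: inner_commute)
    qed
    \<comment> \<open>At 0 itself the factor \<open>x ^ k\<close> may vanish, so orthogonality there
      comes from continuity.\<close>
    have "isCont (\<lambda>x. \<xi> x \<bullet> \<xi>t x) 0"
      using real_analytic_on_imp_isCont[OF real_analytic_on_inner[OF \<xi>(1) ana_\<xi>t] \<open>0 \<in> I\<close>] .
    then have "\<xi> 0 \<bullet> \<xi>t 0 = 0"
      using A * isCont_zero_punctured[of 0 "\<lambda>x. \<xi> x \<bullet> \<xi>t x" A] by blast
    then show ?thesis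
      using * that by (cases "x = 0") auto
  qed
  define b where "b = xi_d \<xi>t"
  have b: "norm (b x) = 1" "\<xi> x \<bullet> b x = 0" "\<xi>t x = norm (\<xi>t x) *\<^sub>R b x" if "x \<in> A" for x
    using \<xi>t_nz[OF that] perp[OF that] by (simp_all add: b_def xi_d_def)
  \<comment> \<open>The power \<open>x ^ k\<close> keeps its sign, so the derivative of
    \<open>\<xi>\<close> is \<open>\<delta> x *\<^sub>R b x\<close> on both sides of 0.\<close>
  define \<delta> where "\<delta> x = norm (\<xi>t x) * x ^ k" for x
  have \<xi>_deriv: "(\<xi> has_vector_derivative \<delta> x *\<^sub>R b x) (at x)" if "x \<in> A" for x
    using \<xi>'[of x] b(3)[OF that] A that unfolding \<delta>_def by (metis mult.commute scaleR_scaleR subsetD)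
  have \<gamma>_deriv: "(\<gamma> has_vector_derivative
      p x *\<^sub>R \<xi> x + q x *\<^sub>R b x + r x *\<^sub>R cross3 (\<xi> x) (b x)) (at x)" if "x \<in> A" for x
    using pqr[of x] \<xi>t_nz[OF that] A that unfolding b_def by blast

  \<comment> \<open>Singular points and the striction condition in frame coordinates\<close>
  have singular: "(x, t) \<in> singular_points J F \<longleftrightarrow> x \<in> J \<and> q x + t * \<delta> x = 0 \<and> r x = 0"
    if "x \<in> A" for x t J
    unfolding F using \<gamma>_deriv[OF that] \<xi>_deriv[OF that] unit b(1,2)[OF that] A that
    by (intro singular_points_ruled_surface_iff) auto
  have inner_deriv: "vector_derivative s (at x) \<bullet> b x = q x + t x * \<delta> x"
    if "x \<in> J" "J \<subseteq> A" "open J" "real_analytic_on t J" "\<And>y. y \<in> J \<Longrightarrow> s y = F (y, t y)" for s t x J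
  proof -
    have "x \<in> A" using that by blast
    show ?thesis
      by (rule inner_vector_derivative_ruled_curve[OF \<gamma>_deriv[OF \<open>x \<in> A\<close>] \<xi>_deriv[OF \<open>x \<in> A\<close>]
            b(1,2)[OF \<open>x \<in> A\<close>] real_analytic_on_differentiable[OF that(4,1)] that(3,1)])
        (use that(5) F in auto)
  qed

  \<comment> \<open>The analytic striction parameter\<close>
  have ana_inv_norm: "real_analytic_on (\<lambda>x. inverse (norm (\<xi>t x))) A"
    unfolding norm_eq_sqrt_inner
    by (intro real_analytic_on_inverse_sqrt real_analytic_on_inner ana ana_\<xi>t) (use \<xi>t_nz in simp)
  \<comment> \<open>This solves \<open>q x + t * \<delta> x = 0\<close> after cancelling
    \<open>x ^ k\<close>. As \<open>Q \<ge> k\<close>, the natural subtraction is exact and the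
    solution stays analytic at 0.\<close>
  define t0 where "t0 x = - (qt x * x ^ (Q - k) * inverse (norm (\<xi>t x)))" for x
  have ana_t0: "real_analytic_on t0 A"
    unfolding t0_def
    by (intro real_analytic_on_minus real_analytic_on_mult real_analytic_on_power_ident ana_inv_norm ana q)
  have t0: "q x + t0 x * \<delta> x = 0" if "x \<in> A" for x
  proof -
    have "x ^ Q = x ^ (Q - k) * x ^ k"
      using Q by (simp flip: power_add)
    then show ?thesis
      using that \<xi>t_nz[OF that] A q(2)[of x] by (auto simp: t0_def \<delta>_def)
  qed

  \<comment> \<open>Analyticity of \<open>r\<close>\<close>
  have ana_r: "real_analytic_on r A"
  proof -
    define \<gamma>' where "\<gamma>' x = p x *\<^sub>R \<xi> x + q x *\<^sub>R b x + r x *\<^sub>R cross3 (\<xi> x) (b x)" for x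
    have \<gamma>': "(\<gamma> has_vector_derivative \<gamma>' x) (at x)" if "x \<in> A" for x
      using \<gamma>_deriv[OF that] by (simp add: \<gamma>'_def)
    have comp: "((\<lambda>x. \<gamma> x $ i) has_real_derivative \<gamma>' x $ i) (at x)" if "x \<in> A" for x i
      using bounded_linear.has_vector_derivative[OF bounded_linear_vec_nth \<gamma>'[OF that]]
      by (simp add: has_real_derivative_iff_has_vector_derivative)
    have ana_\<gamma>': "real_analytic_on (\<lambda>x. \<gamma>' x $ i) A" for i
      using real_analytic_on_vec_nth[OF ana[OF \<gamma>(1)]] \<open>open A\<close> comp by (rule real_analytic_on_derivative)
    \<comment> \<open>\<open>r\<close> is the coordinate of \<open>\<gamma>'\<close> along
      \<open>cross3 (\<xi> x) (b x)\<close>; writing \<open>b\<close> as \<open>\<xi>t\<close> over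
      its norm leaves only factors known to be analytic.\<close>
    have "real_analytic_on (\<lambda>x. \<gamma>' x \<bullet> cross3 (\<xi> x) (\<xi>t x) * inverse (norm (\<xi>t x))) A"
      by (intro real_analytic_on_mult ana_inv_norm, unfold inner_vec_def sum_3 inner_real_def cross3_def vector_3)
        (intro real_analytic_on_add real_analytic_on_diff real_analytic_on_mult ana_\<gamma>' real_analytic_on_vec_nth ana \<xi>(1) ana_\<xi>t)
    moreover have "\<gamma>' x \<bullet> cross3 (\<xi> x) (\<xi>t x) * inverse (norm (\<xi>t x)) = r x" if "x \<in> A" for x
    proof -
      have "cross3 (\<xi> x) (b x) \<bullet> cross3 (\<xi> x) (b x) = 1"
        using frame_norm_cross3 unit b(1,2)[OF that] A that by blast
      then have "\<gamma>' x \<bullet> cross3 (\<xi> x) (b x) = r x"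
        by (simp add: \<gamma>'_def inner_simps dot_cross_self)
      then show ?thesis
        by (simp add: b_def xi_d_def cross_mult_right mult.commute)
    qed
    ultimately show ?thesis
      using real_analytic_on_cong[OF \<open>open A\<close>] by fastforce
  qed

  \<comment> \<open>The image of the singular points and the striction curve\<close>
  have curve_image: "F ` (singular_points J F \<inter> {(x, t). x \<in> J \<and> x \<noteq> 0}) = s ` {x \<in> J - {0}. r x = 0}"
    if J: "open_interval_around_0 J" "J \<subseteq> A" and s: "striction_curve J F b s" for J s
  proof -
    have "open J" using J by (simp add: open_interval_around_0_def)
    obtain t where t: "real_analytic_on t J" "\<And>x. x \<in> J \<Longrightarrow> s x = F (x, t x)"
      and "\<And>x. x \<in> J \<Longrightarrow> vector_derivative s (at x) \<bullet> b x = 0"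
      using s unfolding striction_curve_def by blast
    then have t_eq: "q x + t x * \<delta> x = 0" if "x \<in> J" for x
      using inner_deriv[OF that \<open>J \<subseteq> A\<close> \<open>open J\<close> t] that by simp
    \<comment> \<open>For \<open>x \<noteq> 0\<close> the striction equation is linear in
      \<open>t\<close> with nonzero slope, so any striction curve has the same parameter there, and
      the singular points form its graph over the zeros of \<open>r\<close>.\<close>
    have "\<delta> x \<noteq> 0" if "x \<in> J - {0}" for x
      using that J \<xi>t_nz by (auto simp: \<delta>_def)
    then have unique: "u = t x" if "x \<in> J - {0}" "q x + u * \<delta> x = 0" for x u
      using t_eq[of x] that by (metis DiffD1 add_left_cancel mult_right_cancel)
    have "(x, u) \<in> singular_points J F \<longleftrightarrow> u = t x \<and> r x = 0" if "x \<in> J - {0}" for x u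
      using singular[of x u J] unique[OF that, of u] t_eq[of x] that \<open>J \<subseteq> A\<close> by blast
    then have "singular_points J F \<inter> {(x, t). x \<in> J \<and> x \<noteq> 0} = (\<lambda>x. (x, t x)) ` {x \<in> J - {0}. r x = 0}"
      by auto
    then show ?thesis
      using t(2) by (auto simp: image_image)
  qed
  have striction_exists: "striction_curve J F b (\<lambda>x. F (x, t0 x))"
    if J: "open_interval_around_0 J" "J \<subseteq> A" for J
  proof -
    have "open J" "real_analytic_on t0 J"
      using J real_analytic_on_subset[OF ana_t0] by (auto simp: open_interval_around_0_def)
    moreover have "vector_derivative (\<lambda>x. F (x, t0 x)) (at x) \<bullet> b x = 0" if "x \<in> J" for x
      using inner_deriv[OF that \<open>J \<subseteq> A\<close> calculation refl] t0[of x] that \<open>J \<subseteq> A\<close> by auto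
    ultimately show ?thesis
      unfolding striction_curve_def by blast
  qed

  \<comment> \<open>The dichotomy for \<open>r\<close> near 0\<close>
  define factors where "factors J \<longleftrightarrow> (\<exists>(rt :: real \<Rightarrow> real) (R :: nat).
      real_analytic_on rt J \<and> (\<forall>x\<in>J. r x = rt x * x ^ R) \<and> rt 0 \<noteq> 0)" for J
  \<comment> \<open>Each alternative decides both the zeros of \<open>r\<close> and
    \<open>factors J\<close>, for all small \<open>J\<close> at once.\<close>
  have "\<exists>d>0. \<forall>J. open_interval_around_0 J \<and> J \<subseteq> ball 0 d \<longrightarrow>
      (\<forall>x\<in>J. r x = 0) \<and> \<not> factors J \<or> (\<forall>x\<in>J - {0}. r x \<noteq> 0) \<and> factors J"
    using ana_r \<open>0 \<in> A\<close>
  proof (cases rule: real_analytic_on_zero_or_factor)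
    case (1 d)
    have "(\<forall>x\<in>J. r x = 0) \<and> \<not> factors J" if J: "open_interval_around_0 J" "J \<subseteq> ball 0 d" for J
    proof
      have "open J" "0 \<in> J"
        using J by (auto simp: open_interval_around_0_def)
      show r0: "\<forall>x\<in>J. r x = 0"
        using 1 J by blast
      show "\<not> factors J"
      proof
        assume "factors J"
        then obtain rt R where rt: "real_analytic_on rt J" "\<And>x. x \<in> J \<Longrightarrow> r x = rt x * x ^ R" "rt 0 \<noteq> 0"
          unfolding factors_def by blast
        \<comment> \<open>If \<open>r\<close> vanishes, then \<open>rt\<close> vanishes off 0, and
          its continuity contradicts \<open>rt 0 \<noteq> 0\<close>.\<close>
        have "rt x = 0" if "x \<in> J - {0}" for x
          using rt(2)[of x] r0 that by auto
        then show False
          using isCont_zero_punctured[OF real_analytic_on_imp_isCont[OF rt(1)]] \<open>open J\<close> \<open>0 \<in> J\<close> rt(3) by blast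
      qed
    qed
    then show ?thesis
      using 1 by blast
  next
    case (2 d h n)
    have "(\<forall>x\<in>J - {0}. r x \<noteq> 0) \<and> factors J" if J: "open_interval_around_0 J" "J \<subseteq> ball 0 d" for J
    proof
      have "0 \<in> J"
        using J by (auto simp: open_interval_around_0_def)
      show "\<forall>x\<in>J - {0}. r x \<noteq> 0"
        using 2(3,4) J by (metis DiffD1 DiffD2 insertI1 mult_eq_0_iff power_not_zero subsetD)
      have "h 0 \<noteq> 0"
        using 2(4) J \<open>0 \<in> J\<close> by blast
      moreover have "\<forall>x\<in>J. r x = h x * x ^ n"
        using 2(3) J by blast
      ultimately show "factors J"
        unfolding factors_def using real_analytic_on_subset[OF 2(2) J(2)] by blast
    qed
    then show ?thesis
      using 2 by blast
  qed
  then obtain d where "d > 0" and dichotomy: "\<And>J. open_interval_around_0 J \<Longrightarrow> J \<subseteq> ball 0 d \<Longrightarrow>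
      (\<forall>x\<in>J. r x = 0) \<and> \<not> factors J \<or> (\<forall>x\<in>J - {0}. r x \<noteq> 0) \<and> factors J"
    by blast

  \<comment> \<open>The two equivalences on small intervals\<close>
  show ?thesis
    unfolding Let_def factors_def[symmetric] b_def[symmetric]
  \<comment> \<open>Radius \<open>e\<close> secures the frame, radius \<open>d\<close> the dichotomy
    for \<open>r\<close>.\<close>
  proof (intro exI[of _ "ball 0 (min e d)"] conjI allI impI)
    show "open_interval_around_0 (ball 0 (min e d))"
      using \<open>e > 0\<close> \<open>d > 0\<close> by (simp add: open_interval_around_0_def is_interval_ball_real)
    show "ball 0 (min e d) \<subseteq> I"
      using A by (auto simp: A_def)
    fix J assume "open_interval_around_0 J \<and> J \<subseteq> ball 0 (min e d)"
    then have J: "open_interval_around_0 J" "J \<subseteq> A" "J \<subseteq> ball 0 d"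
      by (auto simp: A_def)
    then have nonempty: "J - {0} \<noteq> {}"
      using open_minus_point_nonempty by (auto simp: open_interval_around_0_def)
    show striction: "\<exists>s. striction_curve J F b s"
      using striction_exists J by blast
    \<comment> \<open>The zeros of \<open>r\<close> off 0 fill \<open>J - {0}\<close> or are absent.
      As \<open>J - {0}\<close> is nonempty, its image under \<open>s\<close> is nonempty, so these
      two cases give different answers in both equivalences.\<close>
    have cases: "(\<forall>x\<in>J. r x = 0) \<and> \<not> factors J \<and> {x \<in> J - {0}. r x = 0} = J - {0} \<or>
        \<not> (\<forall>x\<in>J. r x = 0) \<and> factors J \<and> {x \<in> J - {0}. r x = 0} = {}"
      using dichotomy[OF J(1,3)] nonempty by blast
    show "F ` (singular_points J F \<inter> {(x, t). x \<in> J \<and> x \<noteq> 0}) = s ` (J - {0}) \<longleftrightarrow> (\<forall>x\<in>J. r x = 0)"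
      if "striction_curve J F b s" for s
      unfolding curve_image[OF J(1,2) that]
      using cases by (elim disjE conjE) (simp_all only: image_empty empty_is_image nonempty simp_thms)
    show "F ` (singular_points J F \<inter> {(x, t). x \<in> J \<and> x \<noteq> 0}) = {} \<longleftrightarrow> factors J"
    proof -
      \<comment> \<open>The claim does not mention \<open>s\<close>; any striction curve serves to
        express the image of the singular points.\<close>
      obtain s where "striction_curve J F b s"
        using striction by blast
      show ?thesis
        unfolding curve_image[OF J(1,2) \<open>striction_curve J F b s\<close>]
        using cases by (elim disjE conjE) (simp_all only: image_empty image_is_empty nonempty simp_thms)
    qed
  qed
qed

end
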